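(* Let $N$ be a timelike ruled surface of type $N_-$ in $\mathbb{R}_1^3$ with timelike striction curve $\vec c$, curvatures $k_1,k_2$ and angle function $\theta$, and let $N^\alpha$ be an $\alpha$-transversal surface of $N$. Then the striction curve $\vec c_\alpha$ of $N^\alpha$ coincides with the striction curve $\vec c$ of $N$ if and only if $$\tanh\theta=\frac{\alpha'+k_1}{k_2}$$ holds on $I$.
   Context: $\mathbb{R}_1^3$ is Minkowski 3-space with metric $\langle\cdot,\cdot\rangle=-dx_1^2+dx_2^2+dx_3^2$. A nonzero vector $\vec v$ is timelike if $\langle\vec v,\vec v\rangle<0$, null if $\langle\vec v,\vec v\rangle=0$, spacelike if $\langle\vec v,\vec v\rangle>0$. Setting. All functions are smooth on an open interval $I$. A timelike ruled surface of type $N_-$ with timelike striction curve is $\vec r(s,v)=\vec c(s)+v\vec q(s)$, with ruling direction $\vec q$ unit timelike, where $\vec c$ is its striction curve, a timelike curve parametrized by arc length $s$. It has a Frenet frame $\{\vec q,\vec h,\vec a\}$ of mutually orthogonal vectors, $\langle\vec q,\vec q\rangle=-1$, $\langle\vec h,\vec h\rangle=\langle\vec a,\vec a\rangle=1$ ($\vec h$ is the central normal, i.e. the surface normal along $\vec c$; $\vec a$ the central tangent), with $\vec q\,'=k_1\vec h$, $\vec h'=k_1\vec q+k_2\vec a$, $\vec a'=-k_2\vec h$ (prime is $d/ds$) for functions $k_1,k_2$. Standing assumption: the derivatives of the frame vectors are non-null and $N$ is non-cylindrical; in particular $k_1\neq0$ and $k_1^2\neq k_2^2$ everywhere. The unit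 tangent of $\vec c$ is $\vec c\,'=\vec t=\cosh\theta\,\vec q+\sinh\theta\,\vec a$ for a real function $\theta$ (the hyperbolic angle between $\vec t$ and $\vec q$). $\alpha$-transversal surface. For a function $\alpha:I\to\mathbb{R}$, $N^\alpha$ is the ruled surface $\vec r_\alpha(s,v)=\vec c(s)+v\vec q_\alpha(s)$ with $\vec q_\alpha=\mu\vec q+\eta\vec h$, where either $(\mu,\eta)=(\cosh\alpha,\sinh\alpha)$ on all of $I$ ($\vec q_\alpha$ timelike) or $(\mu,\eta)=(\sinh\alpha,\cosh\alpha)$ on all of $I$ ($\vec q_\alpha$ spacelike); it is assumed that $\mu\ne0$ and $\eta\neq0$ everywhere and that $\langle\vec q_\alpha',\vec q_\alpha'\rangle\neq0$ everywhere. Its striction curve is $\vec c_\alpha=\vec c+v_\alpha\vec q_\alpha$ with $v_\alpha=-\langle\vec c\,',\vec q_\alpha'\rangle/\langle\vec q_\alpha',\vec q_\alpha'\rangle$; it coincides with $\vec c$ if $v_\alpha=0$ on $I$. Convention: an equation containing a quotient is understood to include that its denominator is nonzero. *)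

theory Defs
  imports "HOL-Analysis.Analysis"
begin

definition lorentz :: "real^3 \<Rightarrow> real^3 \<Rightarrow> real" where
  "lorentz x y = - (x$1 * y$1) + x$2 * y$2 + x$3 * y$3"

definition timelike :: "real^3 \<Rightarrow> bool" where
  "timelike x \<longleftrightarrow> x \<noteq> 0 \<and> lorentz x x < 0"

text \<open>The zero vector has no causal character; in particular it is not null.\<close>

definition null :: "real^3 \<Rightarrow> bool" where
  "null x \<longleftrightarrow> x \<noteq> 0 \<and> lorentz x x = 0"

abbreviation vderiv :: "(real \<Rightarrow> 'a::real_normed_vector) \<Rightarrow> real \<Rightarrow> 'a" where
  "vderiv f s \<equiv> vector_derivative f (at s)"

definition smooth_on :: "real set \<Rightarrow> (real \<Rightarrow> 'a::real_normed_vector) \<Rightarrow> bool" where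
  "smooth_on I f \<longleftrightarrow> (\<forall>n. \<forall>s\<in>I. (vderiv ^^ n) f differentiable (at s))"

definition ruled_surface :: "(real \<Rightarrow> real^3) \<Rightarrow> (real \<Rightarrow> real^3) \<Rightarrow> real \<Rightarrow> real \<Rightarrow> real^3" where
  "ruled_surface c q s v = c s + v *\<^sub>R q s"

definition striction_param :: "(real \<Rightarrow> real^3) \<Rightarrow> (real \<Rightarrow> real^3) \<Rightarrow> real \<Rightarrow> real" where
  "striction_param c q s =
     - lorentz (vderiv c s) (vderiv q s) / lorentz (vderiv q s) (vderiv q s)"

definition striction_curve :: "(real \<Rightarrow> real^3) \<Rightarrow> (real \<Rightarrow> real^3) \<Rightarrow> real \<Rightarrow> real^3" where
  "striction_curve c q s = ruled_surface c q s (striction_param c q s)"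

lemma striction_curve_eq_base_iff:
  assumes "q s \<noteq> 0"
  shows "striction_curve c q s = c s \<longleftrightarrow> striction_param c q s = 0"
  using assms by (simp add: striction_curve_def ruled_surface_def)

text \<open>
  The ruled surface with base curve \<open>c\<close> and timelike rulings \<open>q\<close> (type \<open>N\<^sub>-\<close>), whose striction
  curve is the timelike arc-length parametrized curve \<open>c\<close>. Every tangent plane at a regular
  point contains the timelike vector \<open>q s\<close>, so the surface is automatically timelike there;
  that \<open>h\<close> is orthogonal to the surface along \<open>c\<close> follows from \<open>frame\<close> and \<open>tangent\<close>.
\<close>

locale timelike_ruled_surface =
  fixes I :: "real set"
    and c q h a :: "real \<Rightarrow> real^3"
    and k1 k2 \<theta> :: "real \<Rightarrow> real"
  assumes interval: "open I" "is_interval I" "I \<noteq> {}"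
    and smooth: "smooth_on I c" "smooth_on I q" "smooth_on I h" "smooth_on I a"
      "smooth_on I k1" "smooth_on I k2" "smooth_on I \<theta>"
    and frame: "\<And>s. s \<in> I \<Longrightarrow> lorentz (q s) (q s) = -1"
      "\<And>s. s \<in> I \<Longrightarrow> lorentz (h s) (h s) = 1"
      "\<And>s. s \<in> I \<Longrightarrow> lorentz (a s) (a s) = 1"
      "\<And>s. s \<in> I \<Longrightarrow> lorentz (q s) (h s) = 0"
      "\<And>s. s \<in> I \<Longrightarrow> lorentz (q s) (a s) = 0"
      "\<And>s. s \<in> I \<Longrightarrow> lorentz (h s) (a s) = 0"
    and frenet: "\<And>s. s \<in> I \<Longrightarrow> (q has_vector_derivative k1 s *\<^sub>R h s) (at s)"
      "\<And>s. s \<in> I \<Longrightarrow> (h has_vector_derivative k1 s *\<^sub>R q s + k2 s *\<^sub>R a s) (at s)"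
      "\<And>s. s \<in> I \<Longrightarrow> (a has_vector_derivative - k2 s *\<^sub>R h s) (at s)"
    and non_cylindrical: "\<And>s. s \<in> I \<Longrightarrow> vderiv q s \<noteq> 0"
    and non_null: "\<And>s. s \<in> I \<Longrightarrow> \<not> null (vderiv q s)"
      "\<And>s. s \<in> I \<Longrightarrow> \<not> null (vderiv h s)"
      "\<And>s. s \<in> I \<Longrightarrow> \<not> null (vderiv a s)"
    and striction: "\<And>s. s \<in> I \<Longrightarrow> striction_curve c q s = c s"
    and timelike_arclength: "\<And>s. s \<in> I \<Longrightarrow> timelike (vderiv c s)"
      "\<And>s. s \<in> I \<Longrightarrow> lorentz (vderiv c s) (vderiv c s) = -1"
    and tangent: "\<And>s. s \<in> I \<Longrightarrow>
      (c has_vector_derivative cosh (\<theta> s) *\<^sub>R q s + sinh (\<theta> s) *\<^sub>R a s) (at s)"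
begin

lemma curvatures:
  assumes s: "s \<in> I"
  shows "k1 s \<noteq> 0" and "(k1 s)\<^sup>2 \<noteq> (k2 s)\<^sup>2"
proof -
  have q': "vderiv q s = k1 s *\<^sub>R h s" and h': "vderiv h s = k1 s *\<^sub>R q s + k2 s *\<^sub>R a s"
    using frenet[OF s] by (auto intro: vector_derivative_at)
  show k1: "k1 s \<noteq> 0"
    using non_cylindrical[OF s] q' by auto
  have "lorentz (vderiv h s) (q s) = k1 s * lorentz (q s) (q s) + k2 s * lorentz (q s) (a s)"
    unfolding h' by (simp add: lorentz_def algebra_simps)
  then have "lorentz (vderiv h s) (q s) \<noteq> 0"
    using k1 frame[OF s] by simp
  then have "vderiv h s \<noteq> 0"
    by (auto simp: lorentz_def)
  then have nz: "lorentz (vderiv h s) (vderiv h s) \<noteq> 0"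
    using non_null(2)[OF s] by (simp add: null_def)
  have "lorentz (vderiv h s) (vderiv h s) = (k1 s)\<^sup>2 * lorentz (q s) (q s)
      + 2 * k1 s * k2 s * lorentz (q s) (a s) + (k2 s)\<^sup>2 * lorentz (a s) (a s)"
    unfolding h' by (simp add: lorentz_def algebra_simps power2_eq_square)
  then show "(k1 s)\<^sup>2 \<noteq> (k2 s)\<^sup>2"
    using nz frame[OF s] by simp
qed

end

definition transversal_ruling ::
  "(real \<Rightarrow> real) \<Rightarrow> (real \<Rightarrow> real) \<Rightarrow> (real \<Rightarrow> real^3) \<Rightarrow> (real \<Rightarrow> real^3) \<Rightarrow> real \<Rightarrow> real^3" where
  "transversal_ruling \<mu> \<eta> q h s = \<mu> s *\<^sub>R q s + \<eta> s *\<^sub>R h s"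

locale alpha_transversal_surface = timelike_ruled_surface I c q h a k1 k2 \<theta>
  for I c q h a k1 k2 \<theta> +
  fixes \<alpha> \<mu> \<eta> :: "real \<Rightarrow> real"
  assumes smooth_alpha: "smooth_on I \<alpha>"
    and coefficients: "(\<forall>s\<in>I. \<mu> s = cosh (\<alpha> s) \<and> \<eta> s = sinh (\<alpha> s)) \<or>
      (\<forall>s\<in>I. \<mu> s = sinh (\<alpha> s) \<and> \<eta> s = cosh (\<alpha> s))"
    and coefficients_nonzero: "\<And>s. s \<in> I \<Longrightarrow> \<mu> s \<noteq> 0" "\<And>s. s \<in> I \<Longrightarrow> \<eta> s \<noteq> 0"
    and ruling_deriv: "\<And>s. s \<in> I \<Longrightarrow>
      lorentz (vderiv (transversal_ruling \<mu> \<eta> q h) s) (vderiv (transversal_ruling \<mu> \<eta> q h) s) \<noteq> 0"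

end

theory Submission
  imports Defs
begin

text \<open>
  In both cases of the coefficients \<open>\<mu>' = \<alpha>' \<eta>\<close> and \<open>\<eta>' = \<alpha>' \<mu>\<close>, so the Frenet formulas give
  \<open>q\<^sub>\<alpha>' = (\<alpha>' + k\<^sub>1) (\<eta> q + \<mu> h) + \<eta> k\<^sub>2 a\<close>. Hence
  \<open>\<langle>c', q\<^sub>\<alpha>'\<rangle> = \<eta> (k\<^sub>2 sinh \<theta> - (\<alpha>' + k\<^sub>1) cosh \<theta>)\<close>, and since \<open>\<eta> \<noteq> 0\<close> the striction parameter
  vanishes iff \<open>k\<^sub>2 sinh \<theta> = (\<alpha>' + k\<^sub>1) cosh \<theta>\<close>. Then \<open>k\<^sub>2\<close> cannot vanish, because \<open>k\<^sub>2 = 0\<close>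
  would force \<open>\<alpha>' + k\<^sub>1 = 0\<close> and therefore \<open>q\<^sub>\<alpha>' = 0\<close>.
\<close>

lemma lorentz_simps:
  "lorentz (x + y) z = lorentz x z + lorentz y z"
  "lorentz x (y + z) = lorentz x y + lorentz x z"
  "lorentz (r *\<^sub>R x) y = r * lorentz x y"
  "lorentz x (r *\<^sub>R y) = r * lorentz x y"
  by (simp_all add: lorentz_def algebra_simps)

lemma lorentz_commute: "lorentz x y = lorentz y x"
  by (simp add: lorentz_def mult.commute)

lemma lorentz_zero [simp]: "lorentz 0 x = 0" "lorentz x 0 = 0"
  by (simp_all add: lorentz_def)

context alpha_transversal_surface
begin

lemma alpha_has_derivative:
  assumes "s \<in> I"
  shows "(\<alpha> has_field_derivative deriv \<alpha> s) (at s)"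
proof -
  have "\<alpha> differentiable (at s)"
    using smooth_alpha assms unfolding smooth_on_def by (metis funpow_0)
  then show ?thesis
    by (simp add: DERIV_deriv_iff_real_differentiable)
qed

lemma coefficients_have_derivative:
  assumes s: "s \<in> I"
  shows "(\<mu> has_field_derivative deriv \<alpha> s * \<eta> s) (at s)"
    and "(\<eta> has_field_derivative deriv \<alpha> s * \<mu> s) (at s)"
proof -
  note [derivative_intros] = alpha_has_derivative[OF s]
  have cosh: "((\<lambda>x. cosh (\<alpha> x)) has_field_derivative deriv \<alpha> s * sinh (\<alpha> s)) (at s)"
    and sinh: "((\<lambda>x. sinh (\<alpha> x)) has_field_derivative deriv \<alpha> s * cosh (\<alpha> s)) (at s)"
    by (auto intro!: derivative_eq_intros)
  \<comment> \<open>\<open>\<mu>\<close> and \<open>\<eta>\<close> are hyperbolic functions of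
    \<alpha> on \<open>I\<close> only; openness of \<open>I\<close> makes the agreement local, so
    derivatives carry over.\<close>
  note transfer = has_field_derivative_transform_within_open[OF _ interval(1) s]
  show "(\<mu> has_field_derivative deriv \<alpha> s * \<eta> s) (at s)"
    and "(\<eta> has_field_derivative deriv \<alpha> s * \<mu> s) (at s)"
    using coefficients transfer[OF cosh] transfer[OF sinh] s by auto
qed

lemma transversal_ruling_deriv:
  assumes s: "s \<in> I"
  shows "vderiv (transversal_ruling \<mu> \<eta> q h) s =
    (deriv \<alpha> s + k1 s) *\<^sub>R (\<eta> s *\<^sub>R q s + \<mu> s *\<^sub>R h s) + (\<eta> s * k2 s) *\<^sub>R a s"
proof -
  have "((\<lambda>x. \<mu> x *\<^sub>R q x + \<eta> x *\<^sub>R h x) has_vector_derivative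
      (\<mu> s *\<^sub>R (k1 s *\<^sub>R h s) + (deriv \<alpha> s * \<eta> s) *\<^sub>R q s) +
      (\<eta> s *\<^sub>R (k1 s *\<^sub>R q s + k2 s *\<^sub>R a s) + (deriv \<alpha> s * \<mu> s) *\<^sub>R h s)) (at s)"
    by (intro has_vector_derivative_add has_vector_derivative_scaleR
        coefficients_have_derivative frenet s)
  then have "vderiv (\<lambda>x. \<mu> x *\<^sub>R q x + \<eta> x *\<^sub>R h x) s =
      (\<mu> s *\<^sub>R (k1 s *\<^sub>R h s) + (deriv \<alpha> s * \<eta> s) *\<^sub>R q s) +
      (\<eta> s *\<^sub>R (k1 s *\<^sub>R q s + k2 s *\<^sub>R a s) + (deriv \<alpha> s * \<mu> s) *\<^sub>R h s)"
    by (rule vector_derivative_at)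
  moreover have "transversal_ruling \<mu> \<eta> q h = (\<lambda>x. \<mu> x *\<^sub>R q x + \<eta> x *\<^sub>R h x)"
    by (simp add: fun_eq_iff transversal_ruling_def)
  ultimately show ?thesis
    by (simp add: algebra_simps)
qed

lemma lorentz_tangent_transversal_ruling_deriv:
  assumes s: "s \<in> I"
  shows "lorentz (vderiv c s) (vderiv (transversal_ruling \<mu> \<eta> q h) s) =
    \<eta> s * (k2 s * sinh (\<theta> s) - (deriv \<alpha> s + k1 s) * cosh (\<theta> s))"
  \<comment> \<open>\<open>\<mu>\<close> drops out since the tangent of \<open>c\<close> has no
    \<open>h\<close>-component.\<close>
  unfolding transversal_ruling_deriv[OF s] vector_derivative_at[OF tangent[OF s]]
  using frame[OF s]
  by (simp add: lorentz_simps lorentz_commute[of "a s" "q s"] lorentz_commute[of "a s" "h s"] algebra_simps)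

text \<open>Pairing with \<open>h\<close> isolates \<open>\<eta> s\<close>. Over a zero ruling
  vector the striction point would be \<open>c s\<close> for any parameter.\<close>

lemma transversal_ruling_nonzero:
  assumes s: "s \<in> I"
  shows "transversal_ruling \<mu> \<eta> q h s \<noteq> 0"
proof
  assume "transversal_ruling \<mu> \<eta> q h s = 0"
  then have "lorentz (transversal_ruling \<mu> \<eta> q h s) (h s) = 0"
    by simp
  then show False
    using frame[OF s] coefficients_nonzero(2)[OF s]
    by (simp add: transversal_ruling_def lorentz_simps)
qed

text \<open>The conjunct \<open>k2 s \<noteq> 0\<close> encodes the convention on quotients: as
  \<open>x / 0 = 0\<close> in HOL, the equation alone would also hold for \<open>k2 s = 0\<close>
  and \<open>\<theta> s = 0\<close>.\<close>

lemma striction_curve_transversal_eq_iff: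
  assumes s: "s \<in> I"
  shows "striction_curve c (transversal_ruling \<mu> \<eta> q h) s = c s \<longleftrightarrow>
    k2 s \<noteq> 0 \<and> tanh (\<theta> s) = (deriv \<alpha> s + k1 s) / k2 s"
proof -
  have "striction_curve c (transversal_ruling \<mu> \<eta> q h) s = c s \<longleftrightarrow>
      k2 s * sinh (\<theta> s) = (deriv \<alpha> s + k1 s) * cosh (\<theta> s)"
    unfolding striction_curve_eq_base_iff[of "transversal_ruling \<mu> \<eta> q h", OF transversal_ruling_nonzero[OF s]]
    using ruling_deriv[OF s] coefficients_nonzero(2)[OF s]
    by (simp add: striction_param_def lorentz_tangent_transversal_ruling_deriv[OF s])
  moreover have "deriv \<alpha> s + k1 s \<noteq> 0" if "k2 s = 0"
  proof
    assume "deriv \<alpha> s + k1 s = 0"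
    with that have "vderiv (transversal_ruling \<mu> \<eta> q h) s = 0"
      by (simp add: transversal_ruling_deriv[OF s])
    with ruling_deriv[OF s] show False
      by simp
  qed
  ultimately show ?thesis
    \<comment> \<open>For \<open>k2 s = 0\<close> both sides are false, as cosh is positive;
      otherwise cross-multiply.\<close>
    by (cases "k2 s = 0") (simp, simp add: tanh_def frac_eq_eq mult.commute)
qed

end

theorem theorem4p1:
  fixes I :: "real set"
    and c q h a :: "real \<Rightarrow> real^3"
    and k1 k2 \<theta> \<alpha> \<mu> \<eta> :: "real \<Rightarrow> real"
  assumes "timelike_ruled_surface I c q h a k1 k2 \<theta>"
    and "alpha_transversal_surface I c q h a k1 k2 \<theta> \<alpha> \<mu> \<eta>"
  shows "(\<forall>s\<in>I. striction_curve c (transversal_ruling \<mu> \<eta> q h) s = c s) \<longleftrightarrow>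
    (\<forall>s\<in>I. k2 s \<noteq> 0 \<and> tanh (\<theta> s) = (deriv \<alpha> s + k1 s) / k2 s)"
  using alpha_transversal_surface.striction_curve_transversal_eq_iff[OF assms(2)]
  by (intro ball_cong refl)

end
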